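(* Let $P$ be a finite poset with zeta matrix $Z_P$, let $M_P = Z_P^{-1}$, and set $\mathfrak{Z}_P = Z_P + Z_P^t$ and $\mathfrak{M}_P = M_P + M_P^t$. Then $\det(\mathfrak{M}_P) = \det(\mathfrak{Z}_P)$.
   Context: For a finite poset $P$ with $n$ elements labelled $x_1,\ldots,x_n$ so that $x_i < x_j$ implies $i<j$, the zeta matrix $Z_P$ is the $n\times n$ matrix with $(Z_P)_{ij}=1$ if $x_i\le x_j$ and $(Z_P)_{ij}=0$ otherwise. With this labelling $Z_P$ is unipotent upper triangular, hence invertible; $M_P=Z_P^{-1}$ is called the Möbius matrix of $P$. The superscript $t$ denotes transpose. *)

theory Defs
  imports Complex_Main "Jordan_Normal_Form.Gauss_Jordan_Elimination" "Jordan_Normal_Form.Determinant"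
begin

text \<open>
  A poset is a carrier set \<open>P\<close> with an order relation \<open>r\<close>, where \<open>(x, y) \<in> r\<close> stands for
  \<open>x \<le> y\<close>. The labelled elements are the entries of a list \<open>xs\<close>, with labels
  \<open>0, \<dots>, n - 1\<close> in place of \<open>1, \<dots>, n\<close>.
\<close>

definition order_labelling :: "'a set \<Rightarrow> 'a rel \<Rightarrow> 'a list \<Rightarrow> bool" where
  "order_labelling P r xs \<longleftrightarrow>
     distinct xs \<and> set xs = P \<and>
     (\<forall>i < length xs. \<forall>j < length xs. (xs ! i, xs ! j) \<in> r \<and> xs ! i \<noteq> xs ! j \<longrightarrow> i < j)"

definition zeta_matrix :: "'a rel \<Rightarrow> 'a list \<Rightarrow> real mat" where
  "zeta_matrix r xs =
     mat (length xs) (length xs) (\<lambda>(i, j). if (xs ! i, xs ! j) \<in> r then 1 else 0)"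

text \<open>
  \<open>mat_inverse\<close> returns an option; by \<open>mat_inverse_zeta_matrix\<close> below it is never \<open>None\<close> here.
\<close>

definition moebius_matrix :: "'a rel \<Rightarrow> 'a list \<Rightarrow> real mat" where
  "moebius_matrix r xs = the (mat_inverse (zeta_matrix r xs))"

lemma zeta_matrix_carrier: "zeta_matrix r xs \<in> carrier_mat (length xs) (length xs)"
  by (simp add: zeta_matrix_def)

lemma det_zeta_matrix:
  assumes "partial_order_on P r" and "order_labelling P r xs"
  shows "det (zeta_matrix r xs) = 1"
proof -
  let ?n = "length xs"
  have rf: "(x, x) \<in> r" if "x \<in> P" for x
    using assms(1) that by (auto simp: partial_order_on_def preorder_on_def refl_on_def)
  have diag: "zeta_matrix r xs $$ (i, i) = 1" if "i < ?n" for i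
  proof -
    have "xs ! i \<in> P" using assms(2) that by (auto simp: order_labelling_def)
    with rf that show ?thesis by (simp add: zeta_matrix_def)
  qed
  have "zeta_matrix r xs $$ (i, j) = 0" if "i < ?n" "j < i" for i j
  proof -
    have "xs ! i \<noteq> xs ! j"
      using assms(2) that by (auto simp: order_labelling_def nth_eq_iff_index_eq)
    hence "(xs ! i, xs ! j) \<notin> r"
      using assms(2) that unfolding order_labelling_def by (meson less_trans not_less_iff_gr_or_eq)
    with that show ?thesis by (simp add: zeta_matrix_def)
  qed
  hence "upper_triangular (zeta_matrix r xs)"
    using zeta_matrix_carrier[of r xs] by (auto intro!: upper_triangularI)
  hence "det (zeta_matrix r xs) = prod_list (diag_mat (zeta_matrix r xs))"
    using zeta_matrix_carrier by (rule det_upper_triangular)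
  also have "diag_mat (zeta_matrix r xs) = replicate ?n 1"
    using diag zeta_matrix_carrier[of r xs]
    by (intro nth_equalityI) (auto simp: diag_mat_def)
  finally show ?thesis by simp
qed

lemma mat_inverse_zeta_matrix:
  assumes "partial_order_on P r" and "order_labelling P r xs"
  shows "mat_inverse (zeta_matrix r xs) = Some (moebius_matrix r xs)"
proof (cases "mat_inverse (zeta_matrix r xs)")
  case None
  from mat_inverse(1)[OF zeta_matrix_carrier None]
    det_non_zero_imp_unit[OF zeta_matrix_carrier[of r xs]] det_zeta_matrix[OF assms]
  show ?thesis by fastforce
qed (simp add: moebius_matrix_def)

lemma moebius_matrix_inverse:
  assumes "partial_order_on P r" and "order_labelling P r xs"
  shows "moebius_matrix r xs \<in> carrier_mat (length xs) (length xs)"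
    and "zeta_matrix r xs * moebius_matrix r xs = 1\<^sub>m (length xs)"
    and "moebius_matrix r xs * zeta_matrix r xs = 1\<^sub>m (length xs)"
  using mat_inverse(2)[OF zeta_matrix_carrier mat_inverse_zeta_matrix[OF assms]] by auto

lemma order_labelling_exists:
  assumes "finite P" and po: "partial_order_on P r"
  shows "\<exists>xs. order_labelling P r xs"
proof -
  let ?h = "\<lambda>x. card {y \<in> P. (y, x) \<in> r}"
  obtain ys where ys: "set ys = P" "distinct ys"
    using finite_distinct_list[OF assms(1)] by blast
  define xs where "xs = sort_key ?h ys"
  have xs: "set xs = P" "distinct xs" "sorted (map ?h xs)"
    using ys by (auto simp: xs_def)
  have "i < j"
    if ij: "i < length xs" "j < length xs" "(xs ! i, xs ! j) \<in> r" "xs ! i \<noteq> xs ! j" for i j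
  proof (rule ccontr)
    assume "\<not> i < j"
    hence "?h (xs ! j) \<le> ?h (xs ! i)"
      using sorted_nth_mono[OF xs(3), of j i] ij by simp
    moreover have "?h (xs ! i) < ?h (xs ! j)"
    proof (rule psubset_card_mono)
      have "xs ! j \<in> {y \<in> P. (y, xs ! j) \<in> r}"
        using po xs ij by (auto simp: partial_order_on_def preorder_on_def refl_on_def)
      moreover have "xs ! j \<notin> {y \<in> P. (y, xs ! i) \<in> r}"
        using po ij by (auto simp: partial_order_on_def antisym_def)
      moreover have "{y \<in> P. (y, xs ! i) \<in> r} \<subseteq> {y \<in> P. (y, xs ! j) \<in> r}"
        using po ij by (auto simp: partial_order_on_def preorder_on_def dest: transD)
      ultimately show "{y \<in> P. (y, xs ! i) \<in> r} \<subset> {y \<in> P. (y, xs ! j) \<in> r}"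
        by blast
    qed (use assms(1) in simp)
    ultimately show False by simp
  qed
  with xs show ?thesis unfolding order_labelling_def by blast
qed

end

theory Submission
  imports Defs
begin

text \<open>Congruence by \<open>Z\<close> multiplies a determinant by the square of
  \<open>det Z\<close>, which is 1 because the labelling makes \<open>Z\<close> unitriangular. The
  congruence, \<open>transpose_mult_symmetrized_inverse\<close>, is pure matrix algebra over a
  commutative ring: in the expanded product, \<open>M\<close> cancels the right factor
  \<open>Z\<close>, and the transpose of \<open>M\<close> cancels the left factor.\<close>

text \<open>
  The two symmetrized matrices are congruent: \<open>M Z = 1\<close> gives
  \<open>Z\<^sup>t (M + M\<^sup>t) Z = Z\<^sup>t + Z\<close>, and \<open>det Z = 1\<close>.
\<close>

lemma transpose_mult_symmetrized_inverse:
  fixes A B :: "'a :: comm_ring_1 mat"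
  assumes A: "A \<in> carrier_mat n n" and B: "B \<in> carrier_mat n n" and BA: "B * A = 1\<^sub>m n"
  shows "transpose_mat A * (B + transpose_mat B) * A = A + transpose_mat A"
proof -
  have tA: "transpose_mat A \<in> carrier_mat n n" and tB: "transpose_mat B \<in> carrier_mat n n"
    using A B by auto
  \<comment> \<open>Transposing \<open>B * A = 1\<close> reverses the factors, so the second summand
    collapses from the left.\<close>
  have tt: "transpose_mat A * transpose_mat B = 1\<^sub>m n"
    using transpose_mult[OF B A] BA by simp
  have "transpose_mat A * (B + transpose_mat B) * A = (transpose_mat A * B + 1\<^sub>m n) * A"
    using mult_add_distrib_mat[OF tA B tB] tt by simp
  also have "\<dots> = transpose_mat A * B * A + 1\<^sub>m n * A"
    using tA A B by (intro add_mult_distrib_mat) auto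
  also have "transpose_mat A * B * A = transpose_mat A"
    using assoc_mult_mat[OF tA B A] BA tA by simp
  also have "transpose_mat A + 1\<^sub>m n * A = A + transpose_mat A"
    using comm_add_mat[OF tA A] A by simp
  finally show ?thesis .
qed

theorem theorem1:
  fixes P :: "'a set" and r :: "'a rel" and xs :: "'a list"
  assumes "finite P"
    and "partial_order_on P r"
    and "order_labelling P r xs"
  shows "det (moebius_matrix r xs + transpose_mat (moebius_matrix r xs)) =
         det (zeta_matrix r xs + transpose_mat (zeta_matrix r xs))"
proof -
  let ?n = "length xs" and ?Z = "zeta_matrix r xs" and ?M = "moebius_matrix r xs"
  have Z: "?Z \<in> carrier_mat ?n ?n" by (rule zeta_matrix_carrier)
  note M = moebius_matrix_inverse[OF assms(2,3)]
  have tZ: "transpose_mat ?Z \<in> carrier_mat ?n ?n"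
    and S: "?M + transpose_mat ?M \<in> carrier_mat ?n ?n"
    using Z M(1) by auto
  have "det (?Z + transpose_mat ?Z) = det (transpose_mat ?Z * (?M + transpose_mat ?M) * ?Z)"
    using transpose_mult_symmetrized_inverse[OF Z M(1,3)] by simp
  \<comment> \<open>The left factor contributes \<open>det ?Z\<close> because transposition
    preserves determinants.\<close>
  also have "\<dots> = det ?Z * det (?M + transpose_mat ?M) * det ?Z"
    using det_mult[OF mult_carrier_mat[OF tZ S] Z] det_mult[OF tZ S] det_transpose[OF Z] by simp
  also have "\<dots> = det (?M + transpose_mat ?M)"
    by (simp add: det_zeta_matrix[OF assms(2,3)])
  finally show ?thesis by simp
qed

end
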